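(* Let $G$ be a finite simple graph with $\gamma(G)=k$ and let $\overline{G}$ be its complement. Then: (i) if there exists a $k$-witness of $G$ that is both left-free and right-free, then $\gamma(\overline{G})=k-1$; (ii) otherwise, if there exists a $k$-witness of $G$ that is free, then $\gamma(\overline{G})\le k$; (iii) otherwise, if no $k$-witness of $G$ is free, then $\gamma(\overline{G})\le k+1$.
   Context: All graphs are finite, simple and undirected. A graph $G=(V,E)$ is a star-$k$-PCG if there exist a weight function $w:V\to\mathbb{R}^+$ and $k$ pairwise disjoint intervals $I_1,\dots,I_k$ such that for distinct $u,v\in V$, $uv\in E$ if and only if $w(u)+w(v)\in\bigcup_i I_i$; the weighted graph $G^w$ with these intervals is a $k$-witness. Intervals are $I_i=[a_i,b_i]$ with $b_i<a_{i+1}$. The star number $\gamma(G)$ is the least positive $k$ such that $G$ is a star-$k$-PCG. For distinct $u,v$, $w(uv)=w(u)+w(v)$. For $\gamma(G)=k$, a $k$-witness is left-free if every non-edge $e$ satisfies $w(e)>b_1$, right-free if every non-edge $e$ satisfies $w(e)<a_k$, and free if it is left-free or right-free.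
   Formalization: Part (i) is stated for k ≥ 2 only: for k = 1 a witness that is both left-free and right-free exists exactly for complete graphs, whose edgeless complement has star number 1 (the least positive k), not k − 1 = 0. *)

theory Defs
  imports Complex_Main
begin

definition all_pairs :: "'a set \<Rightarrow> 'a set set" where
  "all_pairs V = {{u, v} | u v. u \<in> V \<and> v \<in> V \<and> u \<noteq> v}"

definition simple_graph :: "'a set \<Rightarrow> 'a set set \<Rightarrow> bool" where
  "simple_graph V E \<longleftrightarrow> finite V \<and> E \<subseteq> all_pairs V"

definition complement :: "'a set \<Rightarrow> 'a set set \<Rightarrow> 'a set set" where
  "complement V E = all_pairs V - E"

(* The intervals are {a i..b i} for i = 1, ..., k; values of a and b at other indices, and of w
   outside V, are irrelevant. *)
definition star_witness ::
  "'a set \<Rightarrow> 'a set set \<Rightarrow> nat \<Rightarrow> ('a \<Rightarrow> real) \<Rightarrow> (nat \<Rightarrow> real) \<Rightarrow> (nat \<Rightarrow> real) \<Rightarrow> bool" where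
  "star_witness V E k w a b \<longleftrightarrow>
     (\<forall>v\<in>V. w v > 0) \<and>
     (\<forall>i\<in>{1..k}. a i \<le> b i) \<and>
     (\<forall>i\<in>{1..<k}. b i < a (i + 1)) \<and>
     (\<forall>u\<in>V. \<forall>v\<in>V. u \<noteq> v \<longrightarrow> ({u, v} \<in> E \<longleftrightarrow> w u + w v \<in> (\<Union>i\<in>{1..k}. {a i..b i})))"

definition star_PCG :: "nat \<Rightarrow> 'a set \<Rightarrow> 'a set set \<Rightarrow> bool" where
  "star_PCG k V E \<longleftrightarrow> (\<exists>w a b. star_witness V E k w a b)"

definition star_number :: "'a set \<Rightarrow> 'a set set \<Rightarrow> nat" where
  "star_number V E = (LEAST k. k > 0 \<and> star_PCG k V E)"

definition left_free :: "'a set \<Rightarrow> 'a set set \<Rightarrow> ('a \<Rightarrow> real) \<Rightarrow> (nat \<Rightarrow> real) \<Rightarrow> bool" where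
  "left_free V E w b \<longleftrightarrow>
     (\<forall>u\<in>V. \<forall>v\<in>V. u \<noteq> v \<and> {u, v} \<notin> E \<longrightarrow> w u + w v > b 1)"

definition right_free :: "'a set \<Rightarrow> 'a set set \<Rightarrow> nat \<Rightarrow> ('a \<Rightarrow> real) \<Rightarrow> (nat \<Rightarrow> real) \<Rightarrow> bool" where
  "right_free V E k w a \<longleftrightarrow>
     (\<forall>u\<in>V. \<forall>v\<in>V. u \<noteq> v \<and> {u, v} \<notin> E \<longrightarrow> w u + w v < a k)"

definition free_witness ::
  "'a set \<Rightarrow> 'a set set \<Rightarrow> nat \<Rightarrow> ('a \<Rightarrow> real) \<Rightarrow> (nat \<Rightarrow> real) \<Rightarrow> (nat \<Rightarrow> real) \<Rightarrow> bool" where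
  "free_witness V E k w a b \<longleftrightarrow> left_free V E w b \<or> right_free V E k w a"

(* Since the star number is positive by definition, "a witness that is left-free and right-free
   implies star number k - 1 for the complement" fails for k = 1: then the graph is complete, and
   its edgeless complement has star number 1. Hence that claim needs 2 \<le> k. *)
lemma star_number_complete_graph:
  fixes V :: "'a set" assumes "finite V"
  shows "simple_graph V (all_pairs V) \<and> star_number V (all_pairs V) = 1
    \<and> (\<exists>w a b. star_witness V (all_pairs V) 1 w a b \<and> left_free V (all_pairs V) w b
          \<and> right_free V (all_pairs V) 1 w a)
    \<and> star_number V (complement V (all_pairs V)) = 1"
proof -
  have in_all: "{u,v} \<in> all_pairs V" if "u \<in> V" "v \<in> V" "u \<noteq> v" for u v
    using that unfolding all_pairs_def by blast
  have w: "star_witness V (all_pairs V) 1 (\<lambda>_. 1) (\<lambda>_. 2) (\<lambda>_. 2)"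
    unfolding star_witness_def using in_all by auto
  have w2: "star_witness V (complement V (all_pairs V)) 1 (\<lambda>_. 1) (\<lambda>_. 3) (\<lambda>_. 3)"
    unfolding star_witness_def complement_def by auto
  have L: "left_free V (all_pairs V) (\<lambda>_. 1) (\<lambda>_. 2)" "right_free V (all_pairs V) 1 (\<lambda>_. 1) (\<lambda>_. 2)"
    unfolding left_free_def right_free_def using in_all by auto
  have "star_number V (all_pairs V) = 1" "star_number V (complement V (all_pairs V)) = 1"
    unfolding star_number_def star_PCG_def
    by (rule Least_equality; use w w2 in force)+
  thus ?thesis using w L assms unfolding simple_graph_def by blast
qed

end

theory Submission
  imports Defs "HOL-Library.Nat_Bijection"
begin

text \<open>
  The weights of the non-edges of a \<open>k\<close>-witness lie in the \<open>k + 1\<close> gaps left by the intervals, the two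
  outer gaps being unbounded. As there are finitely many weights, each gap can be shrunk to a
  compact interval containing the same weights, so the same vertex weights witness that the
  complement is a star-\<open>(k + 1)\<close>-PCG. A left-free (right-free) witness has no non-edge in the first
  (last) gap, which can then be dropped. Applying the bound \<open>k + 1\<close> to the complement
  gives the lower bound in case (i). That the star number is attained at all follows from
  weights for which distinct sets of vertices have distinct total weights.
\<close>

section \<open>Chains of intervals\<close>

definition interval_chain :: "nat \<Rightarrow> (nat \<Rightarrow> 'a::linorder) \<Rightarrow> (nat \<Rightarrow> 'a) \<Rightarrow> bool" where
  "interval_chain k a b \<longleftrightarrow> (\<forall>i\<in>{1..k}. a i \<le> b i) \<and> (\<forall>i\<in>{1..<k}. b i < a (Suc i))"

definition chain_Union :: "nat \<Rightarrow> (nat \<Rightarrow> 'a::linorder) \<Rightarrow> (nat \<Rightarrow> 'a) \<Rightarrow> 'a set" where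
  "chain_Union k a b = (\<Union>i\<in>{1..k}. {a i..b i})"

lemma chain_Union_0 [simp]: "chain_Union 0 a b = {}"
  by (simp add: chain_Union_def)

lemma chain_Union_Suc: "chain_Union (Suc k) a b = chain_Union k a b \<union> {a (Suc k)..b (Suc k)}"
  by (auto simp: chain_Union_def atLeastAtMostSuc_conv)

lemma chain_Union_Suc_shift:
  "chain_Union (Suc k) a b = {a 1..b 1} \<union> chain_Union k (a \<circ> Suc) (b \<circ> Suc)"
  by (induction k) (auto simp: chain_Union_Suc)

lemma chain_Union_cong:
  "(\<And>i. i \<in> {1..k} \<Longrightarrow> a i = a' i \<and> b i = b' i) \<Longrightarrow> chain_Union k a b = chain_Union k a' b'"
  by (simp add: chain_Union_def)

lemma interval_chain_butlast: "interval_chain (Suc k) a b \<Longrightarrow> interval_chain k a b"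
  by (simp add: interval_chain_def)

lemma interval_chain_tl: "interval_chain (Suc k) a b \<Longrightarrow> interval_chain k (a \<circ> Suc) (b \<circ> Suc)"
  by (simp add: interval_chain_def)

lemma finite_set_eq_chain_Union:
  fixes S :: "'a::linorder set"
  assumes "finite S"
  shows "\<exists>c. interval_chain (card S) c c \<and> chain_Union (card S) c c = S"
  using assms
proof (induction S rule: finite_linorder_max_induct)
  case empty
  show ?case by (simp add: interval_chain_def)
next
  case (insert m S)
  then obtain c where chain: "interval_chain (card S) c c" and Union: "chain_Union (card S) c c = S"
    by blast
  let ?k = "card S" and ?c' = "c(Suc (card S) := m)"
  have card: "card (insert m S) = Suc ?k"
    using insert.hyps by (subst card_insert_disjoint) auto
  have "c i < m" if "i \<in> {1..?k}" for i
    using insert.hyps that Union unfolding chain_Union_def by fastforce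
  then have "interval_chain (Suc ?k) ?c' ?c'"
    using chain by (auto simp: interval_chain_def less_Suc_eq)
  moreover have "chain_Union ?k ?c' ?c' = chain_Union ?k c c"
    by (rule chain_Union_cong) simp
  then have "chain_Union (Suc ?k) ?c' ?c' = insert m S"
    by (simp add: chain_Union_Suc Union)
  ultimately show ?case unfolding card by blast
qed

text \<open>The otherwise irrelevant values \<open>b 0\<close> and \<open>a (k + 1)\<close> serve as the far ends of the two outer gaps.\<close>

lemma chain_endpoints_less:
  fixes a b :: "nat \<Rightarrow> 'a::linorder"
  assumes "\<forall>i\<in>{1..k}. a i \<le> b i" "\<forall>i\<le>k. b i < a (Suc i)" "i \<le> k"
  shows "b i < a (Suc k)"
  using assms
proof (induction k)
  case (Suc k)
  show ?case
  proof (cases "i = Suc k")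
    case False
    then have "b i < a (Suc k)" using Suc by simp
    also have "\<dots> \<le> b (Suc k)" using Suc.prems by simp
    also have "\<dots> < a (Suc (Suc k))" using Suc.prems by simp
    finally show ?thesis .
  qed (use Suc.prems in simp)
qed simp

lemma Union_gaps_eq:
  fixes a b :: "nat \<Rightarrow> 'a::linorder"
  assumes "\<forall>i\<in>{1..k}. a i \<le> b i" "\<forall>i\<le>k. b i < a (Suc i)"
  shows "(\<Union>i\<le>k. {b i<..<a (Suc i)}) = {b 0<..<a (Suc k)} - chain_Union k a b"
  using assms
proof (induction k)
  case (Suc k)
  have less: "b i < a (Suc k)" if "i \<le> k" for i
    using chain_endpoints_less[of k a b i] Suc.prems that by simp
  then have below: "x < a (Suc k)" if "x \<in> chain_Union k a b" for x
    using that unfolding chain_Union_def by fastforce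
  have ends: "b 0 < a (Suc k)" "a (Suc k) \<le> b (Suc k)" "b (Suc k) < a (Suc (Suc k))"
    using less Suc.prems by simp_all
  have "(\<Union>i\<le>Suc k. {b i<..<a (Suc i)})
      = ({b 0<..<a (Suc k)} - chain_Union k a b) \<union> {b (Suc k)<..<a (Suc (Suc k))}"
    using Suc by (simp add: atMost_Suc Un_commute)
  also have "\<dots> = {b 0<..<a (Suc (Suc k))} - (chain_Union k a b \<union> {a (Suc k)..b (Suc k)})"
    using ends by (fastforce dest: below)
  finally show ?case by (simp only: chain_Union_Suc)
qed simp

lemma finite_Int_greaterThanLessThan_eq_Icc:
  fixes p q :: "'a::dense_linorder"
  assumes "finite S" "p < q"
  shows "\<exists>c d. p < c \<and> c \<le> d \<and> d < q \<and> S \<inter> {c..d} = S \<inter> {p<..<q}"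
proof -
  obtain m where "p < m" "m < q" using dense[OF \<open>p < q\<close>] by blast
  define T where "T = insert m (S \<inter> {p<..<q})"
  have T: "finite T" "T \<noteq> {}" "T \<subseteq> {p<..<q}"
    using assms(1) \<open>p < m\<close> \<open>m < q\<close> by (auto simp: T_def)
  have "p < Min T" "Min T \<le> Max T" "Max T < q" using T by auto
  moreover have "S \<inter> {p<..<q} \<subseteq> {Min T..Max T}" using T(1) by (auto simp: T_def)
  ultimately show ?thesis by (intro exI[of _ "Min T"] exI[of _ "Max T"]) auto
qed

lemma finite_strict_lower_bound:
  fixes S :: "'a::{linorder, no_bot} set"
  assumes "finite S"
  obtains x where "\<And>s. s \<in> S \<Longrightarrow> x < s"
proof -
  obtain x where "x < Min S" using lt_ex by blast
  then show ?thesis using Min_le[OF assms] that by (meson less_le_trans)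
qed

lemma finite_strict_upper_bound:
  fixes S :: "'a::{linorder, no_top} set"
  assumes "finite S"
  obtains x where "\<And>s. s \<in> S \<Longrightarrow> s < x"
proof -
  obtain x where "Max S < x" using gt_ex by blast
  then show ?thesis using Max_ge[OF assms] that by (meson le_less_trans)
qed

lemma closed_interval_chain_in_gaps:
  fixes a b :: "nat \<Rightarrow> 'a::dense_linorder"
  assumes "finite S" and ab: "\<forall>i\<in>{1..k}. a i \<le> b i" and ba: "\<forall>i\<le>k. b i < a (Suc i)"
  obtains c d where "interval_chain (Suc k) c d"
    "\<And>i. i \<in> {1..Suc k} \<Longrightarrow> b (i - 1) < c i \<and> d i < a i"
    "S \<inter> chain_Union (Suc k) c d = S \<inter> {b 0<..<a (Suc k)} - chain_Union k a b"
proof -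
  have "\<exists>c d. b (i - 1) < c \<and> c \<le> d \<and> d < a i \<and> S \<inter> {c..d} = S \<inter> {b (i - 1)<..<a i}"
    if "i \<in> {1..Suc k}" for i
    using that ba[rule_format, of "i - 1"]
    by (intro finite_Int_greaterThanLessThan_eq_Icc \<open>finite S\<close>) auto
  then obtain c d where ends: "\<And>i. i \<in> {1..Suc k} \<Longrightarrow> b (i - 1) < c i \<and> c i \<le> d i \<and> d i < a i"
    and S_Int: "\<And>i. i \<in> {1..Suc k} \<Longrightarrow> S \<inter> {c i..d i} = S \<inter> {b (i - 1)<..<a i}"
    by metis
  have "d i < c (Suc i)" if "i \<in> {1..k}" for i
  proof -
    have "d i < a i" using ends that by simp
    also have "a i \<le> b i" using ab that by simp
    also have "b i < c (Suc i)" using ends[of "Suc i"] that by simp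
    finally show ?thesis .
  qed
  then have "interval_chain (Suc k) c d"
    using ends by (simp add: interval_chain_def)
  moreover have "S \<inter> chain_Union (Suc k) c d = S \<inter> {b 0<..<a (Suc k)} - chain_Union k a b"
  proof -
    have "S \<inter> chain_Union (Suc k) c d = S \<inter> (\<Union>i\<in>{1..Suc k}. {b (i - 1)<..<a i})"
      unfolding chain_Union_def Int_UN_distrib using S_Int by (intro SUP_cong) simp_all
    also have "\<dots> = S \<inter> (\<Union>i\<le>k. {b i<..<a (Suc i)})"
      unfolding image_Suc_atMost[symmetric] by simp
    also have "\<dots> = S \<inter> {b 0<..<a (Suc k)} - chain_Union k a b"
      unfolding Union_gaps_eq[OF ab ba] by blast
    finally show ?thesis .
  qed
  ultimately show thesis using ends by (intro that) simp_all
qed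

lemma interval_chain_complement:
  fixes a b :: "nat \<Rightarrow> 'a::unbounded_dense_linorder"
  assumes "finite S" and ab: "interval_chain k a b"
  obtains c d where "interval_chain (Suc k) c d"
    "\<And>i. i \<in> {1..k} \<Longrightarrow> d i < a i \<and> b i < c (Suc i)"
    "S \<inter> chain_Union (Suc k) c d = S - chain_Union k a b"
proof -
  obtain L where L: "\<And>s. s \<in> S \<union> a ` {1..k} \<Longrightarrow> L < s"
    using finite_strict_lower_bound[of "S \<union> a ` {1..k}"] \<open>finite S\<close> by auto
  obtain R where R: "\<And>s. s \<in> insert L (S \<union> b ` {1..k}) \<Longrightarrow> s < R"
    using finite_strict_upper_bound[of "insert L (S \<union> b ` {1..k})"] \<open>finite S\<close> by auto
  define a' where "a' = a(Suc k := R)"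
  define b' where "b' = b(0 := L)"
  have a'b': "\<forall>i\<in>{1..k}. a' i \<le> b' i"
    using ab by (simp add: interval_chain_def a'_def b'_def)
  have b'a': "\<forall>i\<le>k. b' i < a' (Suc i)"
    using ab L R by (auto simp: interval_chain_def a'_def b'_def)
  obtain c d where "interval_chain (Suc k) c d"
    and in_gap: "\<And>i. i \<in> {1..Suc k} \<Longrightarrow> b' (i - 1) < c i \<and> d i < a' i"
    and "S \<inter> chain_Union (Suc k) c d = S \<inter> {b' 0<..<a' (Suc k)} - chain_Union k a' b'"
    using closed_interval_chain_in_gaps[OF \<open>finite S\<close> a'b' b'a'] by metis
  moreover have "S \<inter> {b' 0<..<a' (Suc k)} = S"
    using L R by (auto simp: a'_def b'_def)
  moreover have "chain_Union k a' b' = chain_Union k a b"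
    by (rule chain_Union_cong) (simp add: a'_def b'_def)
  moreover have "d i < a i \<and> b i < c (Suc i)" if "i \<in> {1..k}" for i
    using in_gap[of i] in_gap[of "Suc i"] that by (simp add: a'_def b'_def)
  ultimately show thesis by (intro that) simp_all
qed

section \<open>Witnesses in terms of edge weights\<close>

lemma ball_all_pairs: "(\<forall>e\<in>all_pairs V. P e) \<longleftrightarrow> (\<forall>u\<in>V. \<forall>v\<in>V. u \<noteq> v \<longrightarrow> P {u, v})"
  unfolding all_pairs_def by blast

lemma all_pairs_subset_Pow: "all_pairs V \<subseteq> Pow V"
  by (auto simp: all_pairs_def)

lemma complement_complement: "E \<subseteq> all_pairs V \<Longrightarrow> complement V (complement V E) = E"
  unfolding complement_def by blast

lemma simple_graph_complement: "simple_graph V E \<Longrightarrow> simple_graph V (complement V E)"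
  unfolding simple_graph_def complement_def by blast

lemma star_witness_iff:
  "star_witness V E k w a b \<longleftrightarrow> (\<forall>v\<in>V. 0 < w v) \<and> interval_chain k a b \<and>
    (\<forall>e\<in>all_pairs V. e \<in> E \<longleftrightarrow> sum w e \<in> chain_Union k a b)"
  by (simp add: star_witness_def interval_chain_def chain_Union_def ball_all_pairs)

lemma ball_complement:
  "(\<forall>e\<in>complement V E. P e) \<longleftrightarrow> (\<forall>u\<in>V. \<forall>v\<in>V. u \<noteq> v \<and> {u, v} \<notin> E \<longrightarrow> P {u, v})"
  using ball_all_pairs[of V "\<lambda>e. e \<notin> E \<longrightarrow> P e"] by (auto simp: complement_def)

lemma left_free_iff: "left_free V E w b \<longleftrightarrow> (\<forall>e\<in>complement V E. b 1 < sum w e)"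
  by (simp add: left_free_def ball_complement)

lemma right_free_iff: "right_free V E k w a \<longleftrightarrow> (\<forall>e\<in>complement V E. sum w e < a k)"
  by (simp add: right_free_def ball_complement)

lemma star_witness_drop_first:
  assumes "star_witness V E (Suc k) w a b" "\<forall>e\<in>E. b 1 < sum w e"
  shows "star_witness V E k w (a \<circ> Suc) (b \<circ> Suc)"
  using assms interval_chain_tl unfolding star_witness_iff chain_Union_Suc_shift by fastforce

lemma star_witness_drop_last:
  assumes "star_witness V E (Suc k) w a b" "\<forall>e\<in>E. sum w e < a (Suc k)"
  shows "star_witness V E k w a b"
  using assms interval_chain_butlast unfolding star_witness_iff chain_Union_Suc by fastforce

section \<open>The star number is attained\<close>

lemma distinct_subset_sum_weights_exist:
  assumes "finite V"
  obtains w :: "'a \<Rightarrow> 'b::linordered_semidom" where "\<And>v. 0 < w v" "inj_on (sum w) (Pow V)"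
proof -
  obtain f :: "'a \<Rightarrow> nat" where f: "inj_on f V"
    using finite_imp_inj_to_nat_seg[OF assms] by blast
  define w :: "'a \<Rightarrow> 'b" where "w v = 2 ^ f v" for v
  have "sum w A = of_nat (set_encode (f ` A))" if "A \<subseteq> V" for A
    using inj_on_subset[OF f that] by (simp add: set_encode_def sum.reindex w_def)
  moreover have "inj_on (\<lambda>A. set_encode (f ` A)) (Pow V)"
  proof (rule inj_onI)
    fix A B assume AB: "A \<in> Pow V" "B \<in> Pow V" "set_encode (f ` A) = set_encode (f ` B)"
    then have "finite (f ` A)" "finite (f ` B)" using assms by (auto intro: finite_subset)
    then have "f ` A = f ` B" using AB(3) by (simp add: set_encode_eq)
    then show "A = B" using AB f by (simp add: inj_on_image_eq_iff)
  qed
  ultimately have "inj_on (sum w) (Pow V)" by (simp add: inj_on_def)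
  then show thesis by (intro that) (simp_all add: w_def)
qed

lemma star_PCG_exists:
  assumes "simple_graph V E"
  shows "\<exists>k>0. star_PCG k V E"
proof -
  have "finite V" and E: "E \<subseteq> all_pairs V" using assms by (auto simp: simple_graph_def)
  then have "finite E" using all_pairs_subset_Pow by (meson finite_Pow_iff finite_subset)
  obtain w :: "'a \<Rightarrow> real" where pos: "\<And>v. 0 < w v" and inj: "inj_on (sum w) (Pow V)"
    using distinct_subset_sum_weights_exist[OF \<open>finite V\<close>] by blast
  \<comment> \<open>The value 0 is the weight of no edge; it makes the number of intervals positive.\<close>
  define S where "S = insert 0 (sum w ` E)"
  have "finite S" using \<open>finite E\<close> by (simp add: S_def)
  then obtain c where chain: "interval_chain (card S) c c" "chain_Union (card S) c c = S"
    using finite_set_eq_chain_Union by blast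
  have "e \<in> E \<longleftrightarrow> sum w e \<in> S" if "e \<in> all_pairs V" for e
  proof -
    have "0 < sum w e"
      using that pos by (intro sum_pos) (auto simp: all_pairs_def)
    moreover have "e \<in> E \<longleftrightarrow> sum w e \<in> sum w ` E"
      using that E all_pairs_subset_Pow by (subst inj_on_image_mem_iff[OF inj]) blast+
    ultimately show ?thesis by (simp add: S_def)
  qed
  then have "star_PCG (card S) V E"
    using pos chain unfolding star_PCG_def star_witness_iff by metis
  moreover have "0 < card S" using \<open>finite S\<close> by (auto simp: S_def card_gt_0_iff)
  ultimately show ?thesis by blast
qed

lemma star_number_attained:
  assumes "simple_graph V E"
  shows "0 < star_number V E" "star_PCG (star_number V E) V E"
  using LeastI_ex[OF star_PCG_exists[OF assms]] unfolding star_number_def by auto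

lemma star_number_le: "0 < k \<Longrightarrow> star_PCG k V E \<Longrightarrow> star_number V E \<le> k"
  unfolding star_number_def by (rule Least_le) simp

section \<open>Complements\<close>

lemma first_endpoint_less_if_left_free:
  assumes "star_witness V E k w a b" "left_free V E w b" "0 < k" "e \<in> complement V E"
  shows "a 1 < sum w e"
proof -
  have "a 1 \<le> b 1" using assms by (simp add: star_witness_def)
  also have "\<dots> < sum w e" using assms by (simp add: left_free_iff)
  finally show ?thesis .
qed

lemma less_last_endpoint_if_right_free:
  assumes "star_witness V E k w a b" "right_free V E k w a" "0 < k" "e \<in> complement V E"
  shows "sum w e < b k"
proof -
  have "sum w e < a k" using assms by (simp add: right_free_iff)
  also have "\<dots> \<le> b k" using assms by (simp add: star_witness_def)
  finally show ?thesis .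
qed

lemma star_witness_complement:
  assumes "finite V" "0 < k" and wit: "star_witness V E k w a b"
  obtains c d where "star_witness V (complement V E) (Suc k) w c d"
    "left_free V E w b \<Longrightarrow> \<forall>e\<in>complement V E. d 1 < sum w e"
    "right_free V E k w a \<Longrightarrow> \<forall>e\<in>complement V E. sum w e < c (Suc k)"
proof -
  have "finite (all_pairs V)"
    using \<open>finite V\<close> all_pairs_subset_Pow by (auto intro: finite_subset)
  then obtain c d where "interval_chain (Suc k) c d"
    and interlace: "\<And>i. i \<in> {1..k} \<Longrightarrow> d i < a i \<and> b i < c (Suc i)"
    and "sum w ` all_pairs V \<inter> chain_Union (Suc k) c d = sum w ` all_pairs V - chain_Union k a b"
    using wit interval_chain_complement[of "sum w ` all_pairs V" k a b]
    unfolding star_witness_iff by auto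
  then have "star_witness V (complement V E) (Suc k) w c d"
    using wit unfolding star_witness_iff complement_def by blast
  moreover have "d 1 < a 1" "b k < c (Suc k)"
    using interlace \<open>0 < k\<close> by auto
  ultimately show thesis
    using first_endpoint_less_if_left_free[OF wit _ \<open>0 < k\<close>]
      less_last_endpoint_if_right_free[OF wit _ \<open>0 < k\<close>]
    by (intro that) (blast intro: less_trans)+
qed

lemma star_PCG_complement:
  assumes "finite V" "0 < k" "star_PCG k V E"
  shows "star_PCG (Suc k) V (complement V E)"
  using assms star_witness_complement unfolding star_PCG_def by metis

lemma star_PCG_complement_if_free:
  assumes "finite V" "0 < k" "star_witness V E k w a b" "free_witness V E k w a b"
  shows "star_PCG k V (complement V E)"
proof -
  obtain c d where "star_witness V (complement V E) (Suc k) w c d"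
    and "left_free V E w b \<Longrightarrow> \<forall>e\<in>complement V E. d 1 < sum w e"
    and "right_free V E k w a \<Longrightarrow> \<forall>e\<in>complement V E. sum w e < c (Suc k)"
    using star_witness_complement[OF assms(1-3)] by blast
  then have "star_witness V (complement V E) k w (c \<circ> Suc) (d \<circ> Suc)
      \<or> star_witness V (complement V E) k w c d"
    using assms(4) star_witness_drop_first star_witness_drop_last
    unfolding free_witness_def by blast
  then show ?thesis unfolding star_PCG_def by blast
qed

lemma star_PCG_complement_if_left_right_free:
  assumes "finite V" "star_witness V E (Suc k) w a b"
    and "left_free V E w b" "right_free V E (Suc k) w a"
  shows "star_PCG k V (complement V E)"
proof -
  obtain c d where wit: "star_witness V (complement V E) (Suc (Suc k)) w c d"
    and first: "\<forall>e\<in>complement V E. d 1 < sum w e"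
    and last: "\<forall>e\<in>complement V E. sum w e < c (Suc (Suc k))"
    using star_witness_complement[OF assms(1) zero_less_Suc assms(2)] assms(3,4) by metis
  have "star_witness V (complement V E) (Suc k) w (c \<circ> Suc) (d \<circ> Suc)"
    using wit first by (rule star_witness_drop_first)
  then have "star_witness V (complement V E) k w (c \<circ> Suc) (d \<circ> Suc)"
    by (rule star_witness_drop_last) (simp add: last)
  then show ?thesis unfolding star_PCG_def by blast
qed

lemma star_number_complement_le:
  assumes "simple_graph V E"
  shows "star_number V (complement V E) \<le> star_number V E + 1"
  using star_PCG_complement[OF _ star_number_attained[OF assms]] assms
  by (intro star_number_le) (simp_all add: simple_graph_def)

lemma star_number_le_complement:
  assumes "simple_graph V E"
  shows "star_number V E \<le> star_number V (complement V E) + 1"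
  using star_number_complement_le[OF simple_graph_complement[OF assms]] assms
  by (simp add: complement_complement simple_graph_def)

theorem theorem6:
  fixes V :: "'a set" and E :: "'a set set" and k :: nat
  assumes "simple_graph V E"
    and "star_number V E = k"
  shows "(2 \<le> k \<and>
          (\<exists>w a b. star_witness V E k w a b \<and> left_free V E w b \<and> right_free V E k w a)
          \<longrightarrow> star_number V (complement V E) = k - 1) \<and>
         (\<not> (\<exists>w a b. star_witness V E k w a b \<and> left_free V E w b \<and> right_free V E k w a) \<and>
          (\<exists>w a b. star_witness V E k w a b \<and> free_witness V E k w a b)
          \<longrightarrow> star_number V (complement V E) \<le> k) \<and>
         (\<not> (\<exists>w a b. star_witness V E k w a b \<and> free_witness V E k w a b)
          \<longrightarrow> star_number V (complement V E) \<le> k + 1)"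
proof (intro conjI impI; (elim conjE exE)?)
  have "finite V" "0 < k"
    using assms star_number_attained(1) by (auto simp: simple_graph_def)
  show "star_number V (complement V E) = k - 1"
    if "2 \<le> k" "star_witness V E k w a b" "left_free V E w b" "right_free V E k w a" for w a b
  proof (rule antisym)
    have "star_PCG (k - 1) V (complement V E)"
      using star_PCG_complement_if_left_right_free[OF \<open>finite V\<close>, of _ "k - 1"] that by simp
    then show "star_number V (complement V E) \<le> k - 1"
      using that(1) by (intro star_number_le) simp_all
    show "k - 1 \<le> star_number V (complement V E)"
      using star_number_le_complement[OF assms(1)] assms(2) by simp
  qed
  show "star_number V (complement V E) \<le> k"
    if "star_witness V E k w a b" "free_witness V E k w a b" for w a b
    using star_PCG_complement_if_free[OF \<open>finite V\<close> \<open>0 < k\<close> that] \<open>0 < k\<close>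
    by (intro star_number_le)
  show "star_number V (complement V E) \<le> k + 1"
    using star_number_complement_le[OF assms(1)] assms(2) by simp
qed

end
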